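(* Let $\sigma$ be a term-ordering on $\mathbb{T}^n$, let $I$ be a non-zero ideal in $\mathbb{Q}[x_1,\dots,x_n]$ with reduced $\sigma$-Gröbner basis $G$, and let $p$ be a prime number which does not divide $\mathrm{den}_\sigma(I)$. Then: (a) The set $\pi_p(G)$ is the reduced $\sigma$-Gröbner basis of the ideal $\langle \pi_p(G)\rangle$ of $\mathbb{F}_p[x_1,\dots,x_n]$. (b) The set of the residue classes of the elements of $\mathbb{T}^n\setminus \mathrm{LT}_\sigma(I)$ is an $\mathbb{F}_p$-basis of the quotient ring $\mathbb{F}_p[x_1,\dots,x_n]/\langle \pi_p(G)\rangle$. (c) For every polynomial $f\in\mathbb{Q}[x_1,\dots,x_n]$ such that $p\nmid \mathrm{den}(f)$ we have $\pi_p(\mathrm{NF}_{\sigma,I}(f)) = \mathrm{NF}_{\sigma,\langle\pi_p(G)\rangle}(\pi_p(f))$.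
   Context: $\mathbb{T}^n$ is the monoid of power-products $x_1^{a_1}\cdots x_n^{a_n}$. $\mathrm{LT}_\sigma(f)$ is the $\sigma$-largest power-product in the support of $f\neq0$ (without coefficient), and $\mathrm{LT}_\sigma(I)=\{\mathrm{LT}_\sigma(f): f\in I\setminus\{0\}\}$. $\mathrm{NF}_{\sigma,I}(f)$ is the $\sigma$-normal form of $f$ with respect to $I$: the unique polynomial congruent to $f$ modulo $I$ whose support is contained in $\mathbb{T}^n\setminus\mathrm{LT}_\sigma(I)$. Elements of a reduced Gröbner basis are monic. For $f\in\mathbb{Q}[x_1,\dots,x_n]$, $\mathrm{den}(f)$ is $1$ if $f=0$ and otherwise the least common multiple of the denominators (in lowest terms) of the coefficients of $f$. For a non-zero ideal $I$ with reduced $\sigma$-Gröbner basis $G$, the $\sigma$-denominator of $I$ is $\mathrm{den}_\sigma(I)=\mathrm{lcm}\{\mathrm{den}(g): g\in G\}$. For a positive integer $\delta$, $\mathbb{Z}_\delta$ is the localization of $\mathbb{Z}$ by the multiplicative set generated by $\delta$, i.e. the subring of $\mathbb{Q}$ of fractions $a/\delta^k$ with $a\in\mathbb{Z}$, $k\in\mathbb{N}$. $\mathbb{F}_p=\mathbb{Z}/p\mathbb{Z}$. If $p\nmid\delta$, $\pi_p$ denotes the canonical homomorphism $\mathbb{Z}_\delta\to\mathbb{F}_p$ and its coefficientwise extension $\mathbb{Z}_\delta[x_1,\dots,x_n]\to\mathbb{F}_p[x_1,\dots,x_n]$. *)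

theory Defs
  imports
    "HOL-Library.Poly_Mapping"
    "HOL-Algebra.QuotRing"
    "HOL-Algebra.Algebraic_Closure_Type"
    "Jordan_Normal_Form.Missing_VectorSpace"
    "Berlekamp_Zassenhaus.Finite_Field"
begin

text \<open>Power-products are exponent vectors, so their product is \<open>+\<close> and the power-product 1 is
  \<open>0\<close>. The variables are indexed by a type \<open>'n\<close>, which is finite wherever this matters.\<close>

type_synonym 'n pp = "'n \<Rightarrow>\<^sub>0 nat"

type_synonym ('n, 'a) mpoly = "'n pp \<Rightarrow>\<^sub>0 'a"

definition pp_dvd :: "'n pp \<Rightarrow> 'n pp \<Rightarrow> bool"
  where "pp_dvd s t \<longleftrightarrow> (\<exists>u. t = s + u)"

text \<open>The pair \<open>(s, t)\<close> is in \<open>\<sigma>\<close> if and only if \<open>s\<close> is less than or equal to \<open>t\<close>.\<close>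

definition term_ordering :: "'n pp rel \<Rightarrow> bool"
  where "term_ordering \<sigma> \<longleftrightarrow>
    linear_order \<sigma> \<and> (\<forall>t. (0, t) \<in> \<sigma>) \<and> (\<forall>s t u. (s, t) \<in> \<sigma> \<longrightarrow> (s + u, t + u) \<in> \<sigma>)"

definition LT :: "'n pp rel \<Rightarrow> ('n, 'a::zero) mpoly \<Rightarrow> 'n pp"
  where "LT \<sigma> f = (THE t. t \<in> Poly_Mapping.keys f \<and> (\<forall>s \<in> Poly_Mapping.keys f. (s, t) \<in> \<sigma>))"

definition LT_set :: "'n pp rel \<Rightarrow> ('n, 'a::zero) mpoly set \<Rightarrow> 'n pp set"
  where "LT_set \<sigma> I = LT \<sigma> ` (I - {0})"

abbreviation mpoly_ring :: "('n, 'a::comm_ring_1) mpoly ring"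
  where "mpoly_ring \<equiv> ring_of_type_algebra"

definition groebner_basis ::
    "'n pp rel \<Rightarrow> ('n, 'a::comm_ring_1) mpoly set \<Rightarrow> ('n, 'a) mpoly set \<Rightarrow> bool"
  where "groebner_basis \<sigma> G I \<longleftrightarrow>
    finite G \<and> G \<subseteq> I - {0} \<and> (\<forall>t \<in> LT_set \<sigma> I. \<exists>g \<in> G. pp_dvd (LT \<sigma> g) t)"

definition reduced_groebner_basis ::
    "'n pp rel \<Rightarrow> ('n, 'a::comm_ring_1) mpoly set \<Rightarrow> ('n, 'a) mpoly set \<Rightarrow> bool"
  where "reduced_groebner_basis \<sigma> G I \<longleftrightarrow>
    groebner_basis \<sigma> G I \<and>
    (\<forall>g \<in> G. Poly_Mapping.lookup g (LT \<sigma> g) = 1 \<and>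
      (\<forall>h \<in> G - {g}. \<forall>t \<in> Poly_Mapping.keys g. \<not> pp_dvd (LT \<sigma> h) t))"

definition NF ::
    "'n pp rel \<Rightarrow> ('n, 'a::comm_ring_1) mpoly set \<Rightarrow> ('n, 'a) mpoly \<Rightarrow> ('n, 'a) mpoly"
  where "NF \<sigma> I f = (THE r. f - r \<in> I \<and> Poly_Mapping.keys r \<subseteq> - LT_set \<sigma> I)"

text \<open>The function \<^const>\<open>quotient_of\<close> returns numerator and positive denominator in lowest
  terms. For \<open>f = 0\<close> this is the least common multiple of the empty set, which is 1.\<close>

definition den :: "('n, rat) mpoly \<Rightarrow> nat"
  where "den f = Lcm ((\<lambda>t. nat (snd (quotient_of (Poly_Mapping.lookup f t)))) ` Poly_Mapping.keys f)"

definition den_ideal :: "'n pp rel \<Rightarrow> ('n, rat) mpoly set \<Rightarrow> nat"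
  where "den_ideal \<sigma> I = Lcm (den ` (THE G. reduced_groebner_basis \<sigma> G I))"

text \<open>The field with \<open>p\<close> elements is \<^typ>\<open>'p mod_ring\<close> where \<open>p = CARD('p)\<close> is prime. The
  rationals that lie in the localization of the integers at the powers of \<open>\<delta>\<close> for some \<open>\<delta>\<close>
  prime to \<open>p\<close> are those whose denominator is prime to \<open>p\<close>. The canonical homomorphisms of these
  localizations agree where they overlap, and \<open>mod_p\<close> is their common extension: see
  \<open>mod_p_localization\<close> below. On the other rationals the value of \<open>mod_p\<close> is meaningless.\<close>

definition mod_p :: "rat \<Rightarrow> 'p::prime_card mod_ring"
  where "mod_p q = of_int (fst (quotient_of q)) / of_int (snd (quotient_of q))"

definition mpoly_mod_p :: "('n, rat) mpoly \<Rightarrow> ('n, 'p::prime_card mod_ring) mpoly"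
  where "mpoly_mod_p f = Poly_Mapping.map mod_p f"

lemma of_int_mod_ring_eq_0_iff:
  "(of_int a :: 'p::prime_card mod_ring) = 0 \<longleftrightarrow> int CARD('p) dvd a"
  unfolding of_int_of_int_mod_ring by transfer (auto simp: dvd_eq_mod_eq_0)

lemma mod_p_localization:
  assumes "\<not> CARD('p::prime_card) dvd \<delta>"
  shows "mod_p (of_int a / of_nat \<delta> ^ k) = (of_int a / of_nat \<delta> ^ k :: 'p mod_ring)"
proof -
  let ?q = "of_int a / of_nat \<delta> ^ k :: rat"
  obtain m n where q: "quotient_of ?q = (m, n)" by fastforce
  have n: "n > 0" using quotient_of_denom_pos[OF q] .
  have d0: "\<delta> \<noteq> 0" using assms by (metis dvd_0_right)
  have "?q = of_int m / of_int n" using quotient_of_div[OF q] .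
  then have "of_int (a * n) = (of_int (m * int \<delta> ^ k) :: rat)"
    using n d0 by (simp add: field_simps)
  then have eq: "a * n = m * int \<delta> ^ k" by (simp only: of_int_eq_iff)
  have cop: "coprime m n" using quotient_of_coprime[OF q] .
  have "n dvd m * int \<delta> ^ k" using eq by (metis dvd_triv_right)
  then have nd: "n dvd int \<delta> ^ k"
    using cop by (metis coprime_commute coprime_dvd_mult_right_iff)
  have pd: "\<not> int CARD('p) dvd int \<delta> ^ k"
    using assms prime_card_int[where 'a='p] by (metis int_dvd_int_iff prime_dvd_power)
  have pn: "\<not> int CARD('p) dvd n" using pd nd dvd_trans by blast
  have n': "(of_int n :: 'p mod_ring) \<noteq> 0" using pn by (simp add: of_int_mod_ring_eq_0_iff)
  have "(of_int (int \<delta> ^ k) :: 'p mod_ring) \<noteq> 0"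
    using pd by (simp only: of_int_mod_ring_eq_0_iff not_False_eq_True)
  then have d': "(of_nat \<delta> ^ k :: 'p mod_ring) \<noteq> 0" by simp
  have "(of_int (a * n) :: 'p mod_ring) = of_int (m * int \<delta> ^ k)" by (simp only: eq)
  then have "(of_int a * of_int n :: 'p mod_ring) = of_int m * of_nat \<delta> ^ k" by simp
  then show ?thesis unfolding mod_p_def q using n' d' by (simp add: frac_eq_eq)
qed

text \<open>The ring structure is that of the quotient ring; scalars act through constant
  polynomials.\<close>

definition quotient_space :: "('n, 'a::comm_ring_1) mpoly set \<Rightarrow> ('a, ('n, 'a) mpoly set) module"
  where "quotient_space J = (let Q = mpoly_ring Quot J in
    \<lparr>carrier = carrier Q, monoid.mult = (\<otimes>\<^bsub>Q\<^esub>), one = \<one>\<^bsub>Q\<^esub>, zero = \<zero>\<^bsub>Q\<^esub>, add = (\<oplus>\<^bsub>Q\<^esub>),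
     module.smult = (\<lambda>c A. (J +>\<^bsub>mpoly_ring\<^esub> Poly_Mapping.single 0 c) \<otimes>\<^bsub>Q\<^esub> A)\<rparr>)"

lemma quotient_space_vectorspace:
  fixes J :: "('n, 'a::Fields.field) mpoly set"
  assumes "ideal J mpoly_ring"
  shows "vectorspace (ring_of_type_algebra :: 'a ring) (quotient_space J)"
proof -
  let ?R = "mpoly_ring :: ('n, 'a) mpoly ring"
  let ?K = "ring_of_type_algebra :: 'a ring"
  let ?c = "\<lambda>c. J +>\<^bsub>?R\<^esub> Poly_Mapping.single 0 c"
  interpret J: ideal J ?R by fact
  interpret R: cring ?R by (rule cring_from_type_algebra)
  interpret K: field ?K by (rule field_from_type_algebra)
  interpret Q: cring "?R Quot J" by (rule J.quotient_is_cring) (rule R.cring_axioms)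
  have R_simps: "carrier ?R = UNIV" "(\<otimes>\<^bsub>?R\<^esub>) = (*)" "(\<oplus>\<^bsub>?R\<^esub>) = (+)" "\<one>\<^bsub>?R\<^esub> = 1"
    by (simp_all add: ring_of_type_algebra_def)
  have K_simps: "(\<otimes>\<^bsub>?K\<^esub>) = (*)" "(\<oplus>\<^bsub>?K\<^esub>) = (+)" "\<one>\<^bsub>?K\<^esub> = 1"
    by (simp_all add: ring_of_type_algebra_def)
  have hom: "(+>\<^bsub>?R\<^esub>) J \<in> Ring.ring_hom ?R (?R Quot J)" by (rule J.rcos_ring_hom)
  have closed: "?c a \<in> carrier (?R Quot J)" for a
    using Ring.ring_hom_closed[OF hom] R_simps(1) by auto
  have add: "?c (a + b) = ?c a \<oplus>\<^bsub>?R Quot J\<^esub> ?c b" for a b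
    using Ring.ring_hom_add[OF hom, of "Poly_Mapping.single 0 a" "Poly_Mapping.single 0 b"]
    by (simp add: R_simps single_add)
  have mult: "?c (a * b) = ?c a \<otimes>\<^bsub>?R Quot J\<^esub> ?c b" for a b
    using Ring.ring_hom_mult[OF hom, of "Poly_Mapping.single 0 a" "Poly_Mapping.single 0 b"]
    by (simp add: R_simps mult_single)
  have one: "J +>\<^bsub>?R\<^esub> 1 = \<one>\<^bsub>?R Quot J\<^esub>"
    using Ring.ring_hom_one[OF hom] by (simp add: R_simps)
  have [simp]: "carrier (quotient_space J) = carrier (?R Quot J)"
    "(\<oplus>\<^bsub>quotient_space J\<^esub>) = (\<oplus>\<^bsub>?R Quot J\<^esub>)"
    "\<zero>\<^bsub>quotient_space J\<^esub> = \<zero>\<^bsub>?R Quot J\<^esub>"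
    "c \<odot>\<^bsub>quotient_space J\<^esub> A = ?c c \<otimes>\<^bsub>?R Quot J\<^esub> A" for c A
    by (simp_all add: quotient_space_def Let_def)
  have "abelian_group (quotient_space J)"
    by (rule abelian_groupI)
      (use Q.l_neg in \<open>auto simp: Q.a_ac intro!: bexI[of _ "\<ominus>\<^bsub>?R Quot J\<^esub> _"]\<close>)
  then have "module ?K (quotient_space J)"
    using closed
    by (intro moduleI K.is_cring)
      (auto simp: K_simps add mult one Q.l_distr Q.r_distr Q.m_assoc)
  then show ?thesis
    by (simp add: vectorspace_def K.field_axioms)
qed

end

theory Submission
  imports Defs
begin

text \<open>The theorem rests on the fact that dividing by a monic polynomial never divides a
  coefficient. Since \<open>p\<close> does not divide \<open>den_ideal \<sigma> I\<close>, every element of \<open>G\<close> has coefficients in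
  the ring of rationals whose denominator is prime to \<open>p\<close>, and it is monic. So division by \<open>G\<close> of a
  polynomial \<open>f\<close> with such coefficients takes place over this ring (\<open>division_by_monic\<close>). Its
  remainder is the normal form of \<open>f\<close>, and the division can be read modulo \<open>p\<close>: the polynomial
  \<open>\<pi> f - \<pi> (NF f)\<close> is in \<open>J\<close> (\<open>division_mod_p\<close>).

  Everything else follows once it is known that \<open>J\<close> contains no non-zero polynomial \<open>h\<close> whose terms
  all lie outside \<open>LT_set \<sigma> I\<close> (\<open>irreducible_mod_p_eq_0\<close>).
  Lift \<open>h\<close> in two ways: to an element \<open>F\<close> of \<open>I\<close>, and to a polynomial \<open>H\<close> that has no terms but
  those of \<open>h\<close>. The difference \<open>F - H\<close> vanishes modulo \<open>p\<close>, so \<open>F = H + p E\<close> with \<open>p\<close> prime to the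
  denominator of \<open>E\<close>. The normal form of \<open>F\<close> is 0, that of \<open>H\<close> is \<open>H\<close>, and that of \<open>E\<close> is some \<open>r\<close>
  with denominator prime to \<open>p\<close>. By linearity \<open>0 = H + p r\<close>, and reduction modulo \<open>p\<close> gives
  \<open>h = 0\<close>.

  From this, \<open>groebner_basisI\<close> yields that \<open>\<pi> ` G\<close> is a Groebner basis of \<open>J\<close>: if no leading term of
  \<open>\<pi> ` G\<close> divided the leading term of some non-zero \<open>h \<in> J\<close>, dividing the tail of \<open>h\<close> would give a
  non-zero element of \<open>J\<close> with no reducible term. It is reduced because \<open>\<pi>\<close> keeps the leading terms
  of \<open>G\<close> and creates no new terms, and so \<open>J\<close> and \<open>I\<close> have the same leading terms.
  The basis of the quotient ring expresses that remainders exist and are unique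
  (\<open>quotient_space_basis\<close>), and the statement on normal forms is that \<open>\<pi> (NF f)\<close> has
  the two properties that characterize the normal form of \<open>\<pi> f\<close>.\<close>

section \<open>Polynomials as sums of monomials\<close>

lemma mpoly_eq_sum_monomials:
  fixes f :: "('n, 'a::comm_monoid_add) mpoly"
  shows "f = (\<Sum>t\<in>Poly_Mapping.keys f. Poly_Mapping.single t (Poly_Mapping.lookup f t))"
  by (rule poly_mapping_eqI)
    (auto simp: lookup_sum lookup_single when_def sum.delta' in_keys_iff)

lemma lookup_monomial_mult:
  fixes g :: "('n, 'a::comm_ring_1) mpoly"
  shows "Poly_Mapping.lookup (Poly_Mapping.single u c * g) (u + t) = c * Poly_Mapping.lookup g t"
proof -
  let ?K = "Poly_Mapping.keys g"
  have "Poly_Mapping.single u c * g =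
      (\<Sum>s\<in>?K. Poly_Mapping.single (u + s) (c * Poly_Mapping.lookup g s))"
    by (subst mpoly_eq_sum_monomials[of g]) (simp add: sum_distrib_left mult_single)
  then show ?thesis
    by (auto simp: lookup_sum lookup_single when_def sum.delta' in_keys_iff)
qed

lemma keys_monomial_mult:
  fixes g :: "('n, 'a::comm_ring_1) mpoly"
  assumes "s \<in> Poly_Mapping.keys (Poly_Mapping.single u c * g)"
  obtains t where "t \<in> Poly_Mapping.keys g" "s = u + t"
  using assms keys_mult[of "Poly_Mapping.single u c" g] by (auto split: if_splits)

lemma coeffs_monomial_mult:
  fixes g :: "('n, 'a::comm_ring_1) mpoly"
  assumes "0 \<in> S" and "\<And>x y. x \<in> S \<Longrightarrow> y \<in> S \<Longrightarrow> x * y \<in> S"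
    and "c \<in> S" and "\<And>t. Poly_Mapping.lookup g t \<in> S"
  shows "Poly_Mapping.lookup (Poly_Mapping.single u c * g) s \<in> S"
proof (cases "s \<in> Poly_Mapping.keys (Poly_Mapping.single u c * g)")
  case True
  then obtain t where "s = u + t" by (rule keys_monomial_mult)
  then show ?thesis using assms by (simp add: lookup_monomial_mult)
next
  case False
  then show ?thesis using assms(1) by (simp add: in_keys_iff)
qed

section \<open>Term orderings are well-founded\<close>

lemma pp_dvd_iff_lookup_le:
  "pp_dvd s t \<longleftrightarrow> (\<forall>x. Poly_Mapping.lookup s x \<le> Poly_Mapping.lookup t x)"
proof
  assume "\<forall>x. Poly_Mapping.lookup s x \<le> Poly_Mapping.lookup t x"
  then have "t = s + (t - s)"
    by (intro poly_mapping_eqI) (simp add: lookup_add lookup_minus)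
  then show "pp_dvd s t" by (auto simp: pp_dvd_def)
qed (auto simp: pp_dvd_def lookup_add)

lemma pp_dvd_trans: "pp_dvd s t \<Longrightarrow> pp_dvd t u \<Longrightarrow> pp_dvd s u"
  by (meson pp_dvd_iff_lookup_le order_trans)

lemma pp_dvd_antisym: "pp_dvd s t \<Longrightarrow> pp_dvd t s \<Longrightarrow> s = t"
  by (intro poly_mapping_eqI) (meson pp_dvd_iff_lookup_le order_antisym)

lemma nat_seq_incseq_subseq:
  fixes s :: "nat \<Rightarrow> nat"
  obtains r where "strict_mono r" "incseq (\<lambda>i. s (r i))"
proof -
  obtain q where q: "strict_mono q" "monoseq (\<lambda>i. s (q i))"
    using seq_monosub[of s] by blast
  show thesis
  proof (cases "incseq (\<lambda>i. s (q i))")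
    case True
    then show thesis using q(1) that by blast
  next
    case False
    then have dec: "decseq (\<lambda>i. s (q i))" using q(2) by (simp add: monoseq_iff)
    \<comment> \<open>A decreasing sequence of natural numbers is constant from its minimum on.\<close>
    define m where "m = (LEAST y. y \<in> range (\<lambda>i. s (q i)))"
    have "m \<in> range (\<lambda>i. s (q i))" unfolding m_def by (rule LeastI_ex) auto
    then obtain N where N: "m = s (q N)" by auto
    have least: "m \<le> s (q i)" for i unfolding m_def by (rule Least_le) auto
    have "s (q (N + i)) = m" for i
      using least[of "N + i"] dec N by (simp add: decseq_def order_antisym)
    moreover have "strict_mono (\<lambda>i. q (N + i))"
      using q(1) by (simp add: strict_mono_def)
    ultimately show thesis using that[of "\<lambda>i. q (N + i)"] by (simp add: incseq_def)
  qed
qed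

text \<open>Dickson's lemma: passing to an increasing subsequence once for each variable makes every
  exponent increase.\<close>

lemma dickson:
  fixes f :: "nat \<Rightarrow> 'n::finite pp"
  obtains i j where "i < j" "pp_dvd (f i) (f j)"
proof -
  have "\<exists>r::nat \<Rightarrow> nat. strict_mono r \<and> (\<forall>x\<in>A. incseq (\<lambda>i. Poly_Mapping.lookup (f (r i)) x))"
    for A :: "'n set"
    using finite[of A]
  proof (induction A)
    case empty
    show ?case by (rule exI[of _ id]) (simp add: strict_mono_def)
  next
    case (insert x A)
    then obtain r where r: "strict_mono r"
        "\<forall>y\<in>A. incseq (\<lambda>i. Poly_Mapping.lookup (f (r i)) y)" by blast
    obtain q where q: "strict_mono q" "incseq (\<lambda>i. Poly_Mapping.lookup (f (r (q i))) x)"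
      using nat_seq_incseq_subseq[of "\<lambda>i. Poly_Mapping.lookup (f (r i)) x"] by blast
    have "incseq (\<lambda>i. Poly_Mapping.lookup (f (r (q i))) y)" if "y \<in> A" for y
      using r(2) that strict_mono_mono[OF q(1)] unfolding mono_def by blast
    then show ?case using q r(1)
      by (intro exI[of _ "\<lambda>i. r (q i)"]) (auto simp: strict_mono_def)
  qed
  from this[of UNIV] obtain r where r: "strict_mono r"
      "\<forall>x. incseq (\<lambda>i. Poly_Mapping.lookup (f (r i)) x)" by auto
  have "r 0 < r 1" using r(1) by (simp add: strict_mono_def)
  moreover have "pp_dvd (f (r 0)) (f (r 1))"
    using r(2) by (simp add: pp_dvd_iff_lookup_le incseq_def)
  ultimately show thesis using that by blast
qed

context
  fixes \<sigma> :: "'n::finite pp rel"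
  assumes ord: "term_ordering \<sigma>"
begin

lemma term_refl: "(t, t) \<in> \<sigma>"
  using ord by (auto simp: term_ordering_def linear_order_on_def partial_order_on_def
      preorder_on_def refl_on_def)

lemma term_trans: "(s, t) \<in> \<sigma> \<Longrightarrow> (t, u) \<in> \<sigma> \<Longrightarrow> (s, u) \<in> \<sigma>"
  using ord by (auto simp: term_ordering_def linear_order_on_def partial_order_on_def
      preorder_on_def elim: transE)

lemma term_antisym: "(s, t) \<in> \<sigma> \<Longrightarrow> (t, s) \<in> \<sigma> \<Longrightarrow> s = t"
  using ord by (auto simp: term_ordering_def linear_order_on_def partial_order_on_def
      dest: antisymD)

lemma term_total: "(s, t) \<in> \<sigma> \<or> (t, s) \<in> \<sigma>"
  using ord term_refl by (cases "s = t")
    (auto simp: term_ordering_def linear_order_on_def total_on_def)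

lemma term_add: "(s, t) \<in> \<sigma> \<Longrightarrow> (u + s, u + t) \<in> \<sigma>"
  using ord by (auto simp: term_ordering_def add.commute)

lemma pp_dvd_imp_le: "pp_dvd s t \<Longrightarrow> (s, t) \<in> \<sigma>"
proof -
  assume "pp_dvd s t"
  then obtain u where "t = s + u" by (auto simp: pp_dvd_def)
  moreover have "(0, u) \<in> \<sigma>" using ord by (simp add: term_ordering_def)
  ultimately show "(s, t) \<in> \<sigma>" using term_add[of 0 u s] by simp
qed

text \<open>In an infinite strictly descending chain some term would divide a later one, by Dickson's
  lemma, and hence be less than or equal to it.\<close>

lemma wf_term_ordering: "wf (\<sigma> - Id)"
  unfolding wf_iff_no_infinite_down_chain
proof
  assume "\<exists>f. \<forall>i. (f (Suc i), f i) \<in> \<sigma> - Id"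
  then obtain f where f: "\<And>i. (f (Suc i), f i) \<in> \<sigma> - Id" by blast
  have down: "(f j, f i) \<in> \<sigma>" if "i \<le> j" for i j
    using that
  proof (induction j rule: dec_induct)
    case base
    show ?case by (rule term_refl)
  next
    case (step j)
    have "(f (Suc j), f j) \<in> \<sigma>" using f[of j] by simp
    then show ?case using step.IH by (rule term_trans)
  qed
  obtain i j where ij: "i < j" "pp_dvd (f i) (f j)" by (rule dickson)
  have "(f i, f (Suc i)) \<in> \<sigma>"
    using pp_dvd_imp_le[OF ij(2)] down[of "Suc i" j] ij(1) by (simp add: term_trans)
  then show False using f[of i] term_antisym[of "f i" "f (Suc i)"] by simp
qed

section \<open>Leading terms\<close>

lemma LT_eqI:
  assumes "t \<in> Poly_Mapping.keys f" "\<And>s. s \<in> Poly_Mapping.keys f \<Longrightarrow> (s, t) \<in> \<sigma>"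
  shows "LT \<sigma> f = t"
  unfolding LT_def using assms term_antisym by (intro the_equality) blast+

lemma
  assumes "f \<noteq> 0"
  shows LT_in_keys: "LT \<sigma> f \<in> Poly_Mapping.keys f"
    and LT_ge: "\<And>s. s \<in> Poly_Mapping.keys f \<Longrightarrow> (s, LT \<sigma> f) \<in> \<sigma>"
proof -
  have "Poly_Mapping.keys f \<noteq> {}"
    using assms by (metis ex_in_conv in_keys_iff lookup_zero poly_mapping_eqI)
  with finite_keys[of f]
  have "\<exists>t\<in>Poly_Mapping.keys f. \<forall>s\<in>Poly_Mapping.keys f. (s, t) \<in> \<sigma>"
  proof (induction rule: finite_ne_induct)
    case (singleton x)
    then show ?case by (simp add: term_refl)
  next
    case (insert x F)
    then obtain t where t: "t \<in> F" "\<forall>s\<in>F. (s, t) \<in> \<sigma>" by blast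
    show ?case
    proof (cases "(x, t) \<in> \<sigma>")
      case True
      then show ?thesis using t by blast
    next
      case False
      then have "(t, x) \<in> \<sigma>" using term_total by blast
      then have "\<forall>s\<in>insert x F. (s, x) \<in> \<sigma>" using t term_refl term_trans by blast
      then show ?thesis by blast
    qed
  qed
  then obtain t where t: "t \<in> Poly_Mapping.keys f" "\<forall>s\<in>Poly_Mapping.keys f. (s, t) \<in> \<sigma>"
    by blast
  then have "LT \<sigma> f = t" by (intro LT_eqI) auto
  with t show "LT \<sigma> f \<in> Poly_Mapping.keys f"
    "\<And>s. s \<in> Poly_Mapping.keys f \<Longrightarrow> (s, LT \<sigma> f) \<in> \<sigma>" by auto
qed

section \<open>Division with remainder\<close>

text \<open>Cancelling a leading term with a monic polynomial involves no division of coefficients, so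
  the process stays inside any subring \<open>S\<close> that contains the coefficients of dividend and divisors.
  This is what makes normal forms compatible with reduction modulo a prime. The set \<open>M\<close> need not be
  the set of \<open>S\<close>-combinations of monomial multiples of the divisors: any additively closed set that
  contains these multiples can record a property of the part removed by the division. The bound on
  the terms of the remainder serves to compare leading terms in \<open>groebner_basisI\<close>.\<close>

lemma division_by_monic:
  fixes f :: "('n, 'a::comm_ring_1) mpoly"
  assumes S: "0 \<in> S" "\<And>x y. x \<in> S \<Longrightarrow> y \<in> S \<Longrightarrow> x + y \<in> S" "\<And>x y. x \<in> S \<Longrightarrow> y \<in> S \<Longrightarrow> x - y \<in> S"
      "\<And>x y. x \<in> S \<Longrightarrow> y \<in> S \<Longrightarrow> x * y \<in> S"
    and monic: "\<And>g. g \<in> G \<Longrightarrow> Poly_Mapping.lookup g (LT \<sigma> g) = 1"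
    and G: "\<And>g t. g \<in> G \<Longrightarrow> Poly_Mapping.lookup g t \<in> S"
    and M: "0 \<in> M" "\<And>a b. a \<in> M \<Longrightarrow> b \<in> M \<Longrightarrow> a + b \<in> M"
      "\<And>g u c. g \<in> G \<Longrightarrow> c \<in> S \<Longrightarrow> Poly_Mapping.single u c * g \<in> M"
    and f: "\<And>t. Poly_Mapping.lookup f t \<in> S"
  shows "\<exists>r. (\<forall>t. Poly_Mapping.lookup r t \<in> S) \<and> f - r \<in> M
    \<and> (\<forall>s\<in>Poly_Mapping.keys r. \<not> (\<exists>g\<in>G. pp_dvd (LT \<sigma> g) s))
    \<and> (\<forall>s\<in>Poly_Mapping.keys r. \<exists>t\<in>Poly_Mapping.keys f. (s, t) \<in> \<sigma>)"
    (is "\<exists>r. ?P f r")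
proof (cases "f = 0")
  case True
  then show ?thesis using S(1) M(1) by (intro exI[of _ 0]) simp
next
  case False
  define t where "t = LT \<sigma> f"
  from t_def False f show ?thesis
  proof (induction t arbitrary: f rule: wf_induct_rule[OF wf_term_ordering])
    case (1 t)
    note f0 = \<open>f \<noteq> 0\<close> and fS = \<open>\<And>t. Poly_Mapping.lookup f t \<in> S\<close>
    have t: "t \<in> Poly_Mapping.keys f" "\<And>s. s \<in> Poly_Mapping.keys f \<Longrightarrow> (s, t) \<in> \<sigma>"
      using LT_in_keys[OF f0] LT_ge[OF f0] \<open>t = LT \<sigma> f\<close> by auto
    define c where "c = Poly_Mapping.lookup f t"
    \<comment> \<open>Either way of removing the leading term subtracts a polynomial \<open>h\<close> of this form.\<close>
    have rest: "\<exists>r. (\<forall>s. Poly_Mapping.lookup r s \<in> S) \<and> f - h - r \<in> M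
        \<and> (\<forall>s\<in>Poly_Mapping.keys r. \<not> (\<exists>g\<in>G. pp_dvd (LT \<sigma> g) s))
        \<and> (\<forall>s\<in>Poly_Mapping.keys r. (s, t) \<in> \<sigma>)"
      if hS: "\<And>s. Poly_Mapping.lookup h s \<in> S" and ht: "Poly_Mapping.lookup h t = c"
        and hle: "\<And>s. s \<in> Poly_Mapping.keys h \<Longrightarrow> (s, t) \<in> \<sigma>" for h
    proof (cases "f - h = 0")
      case True
      then show ?thesis using S(1) M(1) by (intro exI[of _ 0]) simp
    next
      case False
      have keys: "(s, t) \<in> \<sigma> - Id" if "s \<in> Poly_Mapping.keys (f - h)" for s
        using that keys_diff[of f h] t(2) hle ht
        by (auto simp: in_keys_iff lookup_minus c_def)
      have "(LT \<sigma> (f - h), t) \<in> \<sigma> - Id" using keys LT_in_keys[OF False] by blast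
      moreover have "Poly_Mapping.lookup (f - h) s \<in> S" for s
        using fS hS S(3) by (simp add: lookup_minus)
      ultimately obtain r where r: "?P (f - h) r" using "1.IH"[OF _ refl False] by blast
      then have "\<forall>s\<in>Poly_Mapping.keys r. (s, t) \<in> \<sigma>" using keys term_trans by blast
      with r show ?thesis by blast
    qed
    show ?case
    proof (cases "\<exists>g\<in>G. pp_dvd (LT \<sigma> g) t")
      case False
      let ?h = "Poly_Mapping.single t c"
      have "\<exists>r. (\<forall>s. Poly_Mapping.lookup r s \<in> S) \<and> f - ?h - r \<in> M
        \<and> (\<forall>s\<in>Poly_Mapping.keys r. \<not> (\<exists>g\<in>G. pp_dvd (LT \<sigma> g) s))
        \<and> (\<forall>s\<in>Poly_Mapping.keys r. (s, t) \<in> \<sigma>)"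
        by (rule rest) (use fS S(1) term_refl in \<open>auto simp: c_def lookup_single when_def split: if_splits\<close>)
      then obtain r where r: "\<forall>s. Poly_Mapping.lookup r s \<in> S" "f - ?h - r \<in> M"
        "\<forall>s\<in>Poly_Mapping.keys r. \<not> (\<exists>g\<in>G. pp_dvd (LT \<sigma> g) s)"
        "\<forall>s\<in>Poly_Mapping.keys r. (s, t) \<in> \<sigma>" by blast
      have "Poly_Mapping.keys (?h + r) \<subseteq> insert t (Poly_Mapping.keys r)"
        using keys_add[of ?h r] by (auto split: if_splits)
      moreover have "Poly_Mapping.lookup (?h + r) s \<in> S" for s
        using r(1) fS S(1,2) by (auto simp: lookup_add lookup_single when_def c_def)
      moreover have "f - (?h + r) \<in> M" using r(2) by (simp add: diff_diff_eq)
      ultimately have "?P f (?h + r)" using r(3,4) False t(1) term_refl by blast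
      then show ?thesis by blast
    next
      case True
      then obtain g u where g: "g \<in> G" "t = LT \<sigma> g + u" by (auto simp: pp_dvd_def)
      let ?h = "Poly_Mapping.single u c * g"
      have tu: "t = u + LT \<sigma> g" using g(2) by (simp add: add.commute)
      have g0: "g \<noteq> 0" using monic[OF g(1)] by auto
      have cS: "c \<in> S" using fS by (simp add: c_def)
      have "\<exists>r. (\<forall>s. Poly_Mapping.lookup r s \<in> S) \<and> f - ?h - r \<in> M
        \<and> (\<forall>s\<in>Poly_Mapping.keys r. \<not> (\<exists>g\<in>G. pp_dvd (LT \<sigma> g) s))
        \<and> (\<forall>s\<in>Poly_Mapping.keys r. (s, t) \<in> \<sigma>)"
      proof (rule rest)
        show "Poly_Mapping.lookup ?h s \<in> S" for s
          using S(1,4) cS G[OF g(1)] by (rule coeffs_monomial_mult)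
        show "Poly_Mapping.lookup ?h t = c"
          using monic[OF g(1)] by (simp add: tu lookup_monomial_mult)
        show "(s, t) \<in> \<sigma>" if "s \<in> Poly_Mapping.keys ?h" for s
          using that by (rule keys_monomial_mult) (simp add: tu term_add LT_ge[OF g0])
      qed
      then obtain r where r: "\<forall>s. Poly_Mapping.lookup r s \<in> S" "f - ?h - r \<in> M"
        "\<forall>s\<in>Poly_Mapping.keys r. \<not> (\<exists>g\<in>G. pp_dvd (LT \<sigma> g) s)"
        "\<forall>s\<in>Poly_Mapping.keys r. (s, t) \<in> \<sigma>" by blast
      have "(f - ?h - r) + ?h \<in> M" using M(2)[OF r(2) M(3)[OF g(1) cS]] .
      then have "f - r \<in> M" by (simp add: algebra_simps)
      then have "?P f r" using r t(1) by blast
      then show ?thesis by blast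
    qed
  qed
qed

end

section \<open>Ideals, Groebner bases and normal forms\<close>

lemma ideal_mpoly_iff:
  fixes I :: "('n, 'a::comm_ring_1) mpoly set"
  shows "ideal I mpoly_ring \<longleftrightarrow>
    0 \<in> I \<and> (\<forall>a\<in>I. \<forall>b\<in>I. a + b \<in> I) \<and> (\<forall>x. \<forall>a\<in>I. x * a \<in> I)"
    (is "_ \<longleftrightarrow> ?R")
proof
  let ?P = "mpoly_ring :: ('n, 'a) mpoly ring"
  assume "ideal I ?P"
  then interpret ideal I ?P .
  have [simp]: "carrier ?P = UNIV" "(\<oplus>\<^bsub>?P\<^esub>) = (+)" "(\<otimes>\<^bsub>?P\<^esub>) = (*)" "\<zero>\<^bsub>?P\<^esub> = 0"
    by (simp_all add: ring_of_type_algebra_def)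
  have "0 \<in> I" using additive_subgroup.zero_closed[OF is_additive_subgroup] by simp
  moreover have "a + b \<in> I" if "a \<in> I" "b \<in> I" for a b
    using additive_subgroup.a_closed[OF is_additive_subgroup that] by simp
  moreover have "x * a \<in> I" if "a \<in> I" for x a
    using I_l_closed[OF that, of x] by simp
  ultimately show ?R by blast
next
  let ?P = "mpoly_ring :: ('n, 'a) mpoly ring"
  assume R: ?R
  interpret P: cring ?P by (rule cring_from_type_algebra)
  have [simp]: "carrier ?P = UNIV" "(\<oplus>\<^bsub>?P\<^esub>) = (+)" "(\<otimes>\<^bsub>?P\<^esub>) = (*)" "\<zero>\<^bsub>?P\<^esub> = 0"
    by (simp_all add: ring_of_type_algebra_def)
  have neg: "\<ominus>\<^bsub>?P\<^esub> a = - a" for a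
    using P.minus_equality[of "- a" a] by simp
  have neg': "- a \<in> I" if "a \<in> I" for a
  proof -
    have "(- 1) * a \<in> I" using R that by blast
    then show ?thesis by simp
  qed
  have "I \<noteq> {}" using R by blast
  then have "subgroup I (add_monoid ?P)"
    using R neg neg' by (intro P.add.subgroupI) (auto simp flip: a_inv_def)
  moreover have "a * x \<in> I" if "a \<in> I" for a x
    using R that by (metis mult.commute)
  ultimately show "ideal I ?P"
    using R by (intro idealI P.ring_axioms) auto
qed

lemma
  fixes I :: "('n, 'a::comm_ring_1) mpoly set"
  assumes "ideal I mpoly_ring"
  shows ideal_zero: "0 \<in> I"
    and ideal_add: "\<And>a b. a \<in> I \<Longrightarrow> b \<in> I \<Longrightarrow> a + b \<in> I"
    and ideal_mult: "\<And>x a. a \<in> I \<Longrightarrow> x * a \<in> I"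
    and ideal_diff: "\<And>a b. a \<in> I \<Longrightarrow> b \<in> I \<Longrightarrow> a - b \<in> I"
proof -
  show "0 \<in> I" and add: "\<And>a b. a \<in> I \<Longrightarrow> b \<in> I \<Longrightarrow> a + b \<in> I"
    and mult: "\<And>x a. a \<in> I \<Longrightarrow> x * a \<in> I"
    using assms by (auto simp: ideal_mpoly_iff)
  show "a - b \<in> I" if "a \<in> I" "b \<in> I" for a b
    using add[OF that(1) mult[OF that(2), of "-1"]] by simp
qed

context
  fixes \<sigma> :: "'n::finite pp rel"
  assumes ord: "term_ordering \<sigma>"
begin

lemma LT_in_LT_set: "f \<in> I \<Longrightarrow> f \<noteq> 0 \<Longrightarrow> LT \<sigma> f \<in> LT_set \<sigma> I"
  by (auto simp: LT_set_def)

lemma pp_dvd_LT_in_LT_set: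
  fixes g :: "('n, 'a::comm_ring_1) mpoly"
  assumes I: "ideal I mpoly_ring" and g: "g \<in> I" "g \<noteq> 0" and dvd: "pp_dvd (LT \<sigma> g) t"
  shows "t \<in> LT_set \<sigma> I"
proof -
  from dvd obtain u where t: "t = u + LT \<sigma> g" by (auto simp: pp_dvd_def add.commute)
  let ?h = "Poly_Mapping.single u 1 * g"
  have key: "t \<in> Poly_Mapping.keys ?h"
    using LT_in_keys[OF ord g(2)] by (simp add: in_keys_iff t lookup_monomial_mult)
  moreover have "(s, t) \<in> \<sigma>" if "s \<in> Poly_Mapping.keys ?h" for s
    using that by (rule keys_monomial_mult) (simp add: t term_add[OF ord] LT_ge[OF ord g(2)])
  ultimately have "LT \<sigma> ?h = t" by (rule LT_eqI[OF ord])
  moreover have "?h \<noteq> 0" using key by auto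
  ultimately show ?thesis using LT_in_LT_set[OF ideal_mult[OF I g(1)]] by metis
qed

lemma LT_set_groebner_basis:
  fixes I :: "('n, 'a::comm_ring_1) mpoly set"
  assumes "ideal I mpoly_ring" and "groebner_basis \<sigma> G I"
  shows "t \<in> LT_set \<sigma> I \<longleftrightarrow> (\<exists>g\<in>G. pp_dvd (LT \<sigma> g) t)"
  using assms pp_dvd_LT_in_LT_set[OF assms(1)] by (auto simp: groebner_basis_def)

lemma irreducible_in_ideal_eq_0:
  assumes "f \<in> I" and "Poly_Mapping.keys f \<subseteq> - LT_set \<sigma> I"
  shows "f = 0"
  using assms LT_in_keys[OF ord, of f] LT_in_LT_set[of f I] by blast

lemma NF_eqI:
  fixes I :: "('n, 'a::comm_ring_1) mpoly set"
  assumes I: "ideal I mpoly_ring"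
    and r: "f - r \<in> I" "Poly_Mapping.keys r \<subseteq> - LT_set \<sigma> I"
  shows "NF \<sigma> I f = r"
  unfolding NF_def
proof (rule the_equality)
  fix q assume q: "f - q \<in> I \<and> Poly_Mapping.keys q \<subseteq> - LT_set \<sigma> I"
  have "q - r \<in> I" using ideal_diff[OF I r(1), of "f - q"] q by (simp add: algebra_simps)
  moreover have "Poly_Mapping.keys (q - r) \<subseteq> - LT_set \<sigma> I" using keys_diff[of q r] q r(2) by blast
  ultimately have "q - r = 0" by (rule irreducible_in_ideal_eq_0)
  then show "q = r" by simp
qed (use r in simp)

text \<open>A term of \<open>g\<close> that lies in \<open>LT_set \<sigma> I\<close> is divisible by the leading term of some member of
  the basis, which must be \<open>g\<close> itself.\<close>

lemma reduced_groebner_basis_tail: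
  assumes "reduced_groebner_basis \<sigma> G I" and g: "g \<in> G"
    and s: "s \<in> Poly_Mapping.keys g" "s \<in> LT_set \<sigma> I"
  shows "s = LT \<sigma> g"
proof -
  obtain h where h: "h \<in> G" "pp_dvd (LT \<sigma> h) s"
    using assms by (auto simp: reduced_groebner_basis_def groebner_basis_def)
  then have "h = g" using assms by (auto simp: reduced_groebner_basis_def)
  then have "(LT \<sigma> g, s) \<in> \<sigma>" using h(2) pp_dvd_imp_le[OF ord] by blast
  moreover have "(s, LT \<sigma> g) \<in> \<sigma>" using s(1) by (intro LT_ge[OF ord]) auto
  ultimately show ?thesis using term_antisym[OF ord] by blast
qed

text \<open>This is the uniqueness of reduced Groebner bases, by symmetry. The leading terms of two
  reduced bases correspond, as each divides one of the other basis. Two elements with the same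
  leading term differ by an element of \<open>I\<close> all of whose terms are non-leading terms of one of the
  two, and by \<open>reduced_groebner_basis_tail\<close> these are not in \<open>LT_set \<sigma> I\<close>.\<close>

lemma reduced_groebner_basis_subset:
  fixes I :: "('n, 'a::comm_ring_1) mpoly set"
  assumes I: "ideal I mpoly_ring"
    and G: "reduced_groebner_basis \<sigma> G I" and H: "reduced_groebner_basis \<sigma> H I"
  shows "G \<subseteq> H"
proof
  fix g assume g: "g \<in> G"
  have GI: "x \<in> I" "x \<noteq> 0" if "x \<in> G" for x
    using G that by (auto simp: reduced_groebner_basis_def groebner_basis_def)
  have HI: "x \<in> I" "x \<noteq> 0" if "x \<in> H" for x
    using H that by (auto simp: reduced_groebner_basis_def groebner_basis_def)
  obtain h where h: "h \<in> H" "pp_dvd (LT \<sigma> h) (LT \<sigma> g)"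
    using H LT_in_LT_set[OF GI[OF g]] by (auto simp: reduced_groebner_basis_def groebner_basis_def)
  obtain g' where g': "g' \<in> G" "pp_dvd (LT \<sigma> g') (LT \<sigma> h)"
    using G LT_in_LT_set[OF HI[OF h(1)]] by (auto simp: reduced_groebner_basis_def groebner_basis_def)
  have "g' = g"
    using G g g' pp_dvd_trans[OF g'(2) h(2)] LT_in_keys[OF ord GI(2)[OF g]]
    by (auto simp: reduced_groebner_basis_def)
  with g'(2) h(2) have LT: "LT \<sigma> h = LT \<sigma> g" by (blast intro: pp_dvd_antisym)
  have "g - h = 0"
  proof (rule ccontr)
    assume ne: "g - h \<noteq> 0"
    let ?s = "LT \<sigma> (g - h)"
    have key: "?s \<in> Poly_Mapping.keys (g - h)" by (rule LT_in_keys[OF ord ne])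
    have "Poly_Mapping.lookup (g - h) (LT \<sigma> g) = 0"
      using G H g h(1) LT by (simp add: reduced_groebner_basis_def lookup_minus)
        (metis diff_self)
    then have s: "?s \<noteq> LT \<sigma> g" using key by (auto simp: in_keys_iff)
    have "?s \<in> LT_set \<sigma> I" by (rule LT_in_LT_set[OF ideal_diff[OF I] ne]) (use GI g HI h in auto)
    then show False
      using reduced_groebner_basis_tail[OF G g, of ?s] reduced_groebner_basis_tail[OF H h(1), of ?s]
        s LT key keys_diff[of g h] by auto
  qed
  then show "g \<in> H" using h(1) by simp
qed

lemma den_ideal_eq:
  assumes "ideal I mpoly_ring" and "reduced_groebner_basis \<sigma> G I"
  shows "den_ideal \<sigma> I = Lcm (den ` G)"
proof -
  have "(THE G. reduced_groebner_basis \<sigma> G I) = G"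
    using assms reduced_groebner_basis_subset[OF assms(1)] by (intro the_equality) blast+
  then show ?thesis by (simp add: den_ideal_def)
qed

text \<open>If the leading term \<open>t\<close> of an element \<open>h\<close> of \<open>J\<close> were not divisible by any leading term of
  \<open>G\<close>, then replacing the tail of \<open>h\<close> by its remainder would give an element of \<open>J\<close> with only
  irreducible terms. It is not zero, because the remainder has only terms less than \<open>t\<close>.\<close>

lemma groebner_basisI:
  fixes J :: "('n, 'a::comm_ring_1) mpoly set"
  assumes J: "ideal J mpoly_ring" and G: "finite G" "G \<subseteq> J"
    and monic: "\<And>g. g \<in> G \<Longrightarrow> Poly_Mapping.lookup g (LT \<sigma> g) = 1"
    and irred: "\<And>h. h \<in> J \<Longrightarrow> \<forall>s\<in>Poly_Mapping.keys h. \<not> (\<exists>g\<in>G. pp_dvd (LT \<sigma> g) s) \<Longrightarrow> h = 0"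
  shows "groebner_basis \<sigma> G J"
proof -
  have "\<exists>g\<in>G. pp_dvd (LT \<sigma> g) (LT \<sigma> h)" if h: "h \<in> J" "h \<noteq> 0" for h
  proof (rule ccontr)
    assume no: "\<not> ?thesis"
    let ?m = "Poly_Mapping.single (LT \<sigma> h) (Poly_Mapping.lookup h (LT \<sigma> h))"
    have "\<exists>r. (\<forall>t. Poly_Mapping.lookup r t \<in> UNIV) \<and> h - ?m - r \<in> J
      \<and> (\<forall>s\<in>Poly_Mapping.keys r. \<not> (\<exists>g\<in>G. pp_dvd (LT \<sigma> g) s))
      \<and> (\<forall>s\<in>Poly_Mapping.keys r. \<exists>t\<in>Poly_Mapping.keys (h - ?m). (s, t) \<in> \<sigma>)"
      using monic J G(2) by (intro division_by_monic[OF ord])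
        (auto simp: ideal_zero ideal_add ideal_mult)
    then obtain r where r: "h - ?m - r \<in> J"
      "\<forall>s\<in>Poly_Mapping.keys r. \<not> (\<exists>g\<in>G. pp_dvd (LT \<sigma> g) s)"
      "\<forall>s\<in>Poly_Mapping.keys r. \<exists>t\<in>Poly_Mapping.keys (h - ?m). (s, t) \<in> \<sigma>" by blast
    have below: "t \<in> Poly_Mapping.keys h \<and> t \<noteq> LT \<sigma> h" if "t \<in> Poly_Mapping.keys (h - ?m)" for t
      using that by (auto simp: in_keys_iff lookup_minus lookup_single when_def split: if_splits)
    have "LT \<sigma> h \<notin> Poly_Mapping.keys r"
    proof
      assume "LT \<sigma> h \<in> Poly_Mapping.keys r"
      then obtain t where "t \<in> Poly_Mapping.keys (h - ?m)" "(LT \<sigma> h, t) \<in> \<sigma>" using r(3) by blast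
      then show False using below[of t] LT_ge[OF ord h(2), of t] term_antisym[OF ord] by blast
    qed
    then have "Poly_Mapping.lookup (?m + r) (LT \<sigma> h) \<noteq> 0"
      using LT_in_keys[OF ord h(2)] by (simp add: lookup_add in_keys_iff)
    moreover have "?m + r = 0"
    proof (rule irred)
      show "?m + r \<in> J" using ideal_diff[OF J h(1) r(1)] by (simp add: algebra_simps)
      show "\<forall>s\<in>Poly_Mapping.keys (?m + r). \<not> (\<exists>g\<in>G. pp_dvd (LT \<sigma> g) s)"
        using keys_add[of ?m r] r(2) no by (auto split: if_splits)
    qed
    ultimately show False by simp
  qed
  moreover have "0 \<notin> G" using monic by fastforce
  ultimately show ?thesis using G by (auto simp: groebner_basis_def LT_set_def)
qed

end

section \<open>Reduction modulo a prime\<close>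

text \<open>The localization of the integers at the ideal generated by a prime \<open>p\<close>.\<close>

definition p_local :: "nat \<Rightarrow> rat set"
  where "p_local p = {q. \<not> int p dvd snd (quotient_of q)}"

definition p_local_mpoly :: "nat \<Rightarrow> ('n, rat) mpoly \<Rightarrow> bool"
  where "p_local_mpoly p f \<longleftrightarrow> (\<forall>t. Poly_Mapping.lookup f t \<in> p_local p)"

text \<open>This description by fractions that need not be in lowest terms makes the closure properties
  and the computation of \<^const>\<open>mod_p\<close> immediate.\<close>

lemma p_local_iff: "q \<in> p_local p \<longleftrightarrow> (\<exists>a b. \<not> p dvd b \<and> q = of_int a / of_nat b)"
proof
  obtain m n where q: "quotient_of q = (m, n)" by fastforce
  have n: "n > 0" using quotient_of_denom_pos[OF q] .
  have qmn: "q = of_int m / of_int n" using quotient_of_div[OF q] .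
  {
    assume "q \<in> p_local p"
    then have "\<not> p dvd nat n"
      using q n by (metis p_local_def mem_Collect_eq snd_conv int_dvd_int_iff int_nat_eq less_imp_le)
    moreover have "q = of_int m / of_nat (nat n)" using qmn n by simp
    ultimately show "\<exists>a b. \<not> p dvd b \<and> q = of_int a / of_nat b" by blast
  next
    assume "\<exists>a b. \<not> p dvd b \<and> q = of_int a / of_nat b"
    then obtain a b where ab: "\<not> p dvd b" "q = of_int a / of_nat b" by blast
    then have "b \<noteq> 0" by (metis dvd_0_right)
    then have "of_int (a * n) = (of_int (m * int b) :: rat)"
      using qmn ab(2) n by (simp add: field_simps)
    then have "a * n = m * int b" by (simp only: of_int_eq_iff)
    then have "n dvd m * int b" by (metis dvd_triv_right)
    then have "n dvd int b"
      using quotient_of_coprime[OF q] by (metis coprime_commute coprime_dvd_mult_right_iff)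
    then show "q \<in> p_local p"
      using ab(1) q by (auto simp: p_local_def) (metis dvd_trans int_dvd_int_iff)
  }
qed

lemma p_localE:
  assumes "q \<in> p_local p"
  obtains a b where "\<not> p dvd b" "b \<noteq> 0" "q = of_int a / of_nat b"
  using assms by (metis p_local_iff dvd_0_right)

lemma p_local_of_int: "prime p \<Longrightarrow> of_int a \<in> p_local p"
  unfolding p_local_iff by (rule exI[of _ a], rule exI[of _ 1]) (auto dest: not_prime_unit)

lemma
  assumes p: "prime p" and q: "q \<in> p_local p" and r: "r \<in> p_local p"
  shows p_local_add: "q + r \<in> p_local p"
    and p_local_diff: "q - r \<in> p_local p"
    and p_local_mult: "q * r \<in> p_local p"
proof -
  obtain a b where ab: "\<not> p dvd b" "b \<noteq> 0" "q = of_int a / of_nat b" using q by (rule p_localE)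
  obtain c d where cd: "\<not> p dvd d" "d \<noteq> 0" "r = of_int c / of_nat d" using r by (rule p_localE)
  have bd: "\<not> p dvd b * d" using ab(1) cd(1) p by (simp add: prime_dvd_mult_iff)
  have "q + r = of_int (a * int d + c * int b) / of_nat (b * d)"
    "q - r = of_int (a * int d - c * int b) / of_nat (b * d)"
    "q * r = of_int (a * c) / of_nat (b * d)"
    unfolding ab(3) cd(3) using ab(2) cd(2) by (simp_all add: add_frac_eq diff_frac_eq)
  then show "q + r \<in> p_local p" "q - r \<in> p_local p" "q * r \<in> p_local p"
    using bd unfolding p_local_iff by blast+
qed

lemma prime_dvd_Lcm_imp_dvd:
  fixes A :: "nat set"
  assumes "prime p" and "finite A" and "p dvd Lcm A"
  obtains a where "a \<in> A" "p dvd a"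
proof -
  have "Lcm A dvd \<Prod>A" using assms(2) by (intro Lcm_least) (simp add: dvd_prodI[of _ _ id, simplified])
  then have "p dvd \<Prod>A" using assms(3) dvd_trans by blast
  then show thesis using that assms by (auto simp: prime_dvd_prod_iff)
qed

lemma not_dvd_den_iff:
  assumes p: "prime p"
  shows "\<not> p dvd den f \<longleftrightarrow> p_local_mpoly p f"
proof -
  have dvd_iff: "p dvd nat (snd (quotient_of q)) \<longleftrightarrow> q \<notin> p_local p" for q
    using quotient_of_denom_pos'[of q]
    by (simp add: p_local_def) (metis int_dvd_int_iff int_nat_eq less_imp_le)
  have zero: "0 \<in> p_local p" using p_local_of_int[OF p, of 0] by simp
  show ?thesis
  proof
    assume nd: "\<not> p dvd den f"
    have "Poly_Mapping.lookup f t \<in> p_local p" for t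
    proof (cases "t \<in> Poly_Mapping.keys f")
      case True
      then have "nat (snd (quotient_of (Poly_Mapping.lookup f t))) dvd den f"
        unfolding den_def by (intro dvd_Lcm) auto
      then show ?thesis using nd dvd_iff dvd_trans by blast
    qed (simp add: in_keys_iff zero)
    then show "p_local_mpoly p f" by (simp add: p_local_mpoly_def)
  next
    assume loc: "p_local_mpoly p f"
    show "\<not> p dvd den f"
    proof
      assume "p dvd den f"
      then obtain a where "a \<in> (\<lambda>t. nat (snd (quotient_of (Poly_Mapping.lookup f t)))) ` Poly_Mapping.keys f"
        "p dvd a" unfolding den_def by (rule prime_dvd_Lcm_imp_dvd[OF p, rotated]) auto
      then show False using loc dvd_iff by (auto simp: p_local_mpoly_def)
    qed
  qed
qed

lemma of_nat_mod_ring_eq_0_iff: "(of_nat b :: 'p::prime_card mod_ring) = 0 \<longleftrightarrow> CARD('p) dvd b"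
  using of_int_mod_ring_eq_0_iff[where 'p='p, of "int b"] by simp

lemma mod_p_fraction:
  assumes "\<not> CARD('p::prime_card) dvd b"
  shows "mod_p (of_int a / of_nat b) = (of_int a / of_nat b :: 'p mod_ring)"
  using mod_p_localization[OF assms, of a 1] by simp

lemma mod_p_of_int: "mod_p (of_int a) = of_int a"
  by (simp add: mod_p_def)

lemma mod_p_0: "mod_p 0 = 0" and mod_p_1: "mod_p 1 = 1"
  by (simp_all add: mod_p_def)

lemma
  assumes q: "q \<in> p_local CARD('p)" and r: "r \<in> p_local CARD('p)"
  shows mod_p_add: "mod_p (q + r) = (mod_p q + mod_p r :: 'p::prime_card mod_ring)"
    and mod_p_diff: "mod_p (q - r) = (mod_p q - mod_p r :: 'p mod_ring)"
    and mod_p_mult: "mod_p (q * r) = (mod_p q * mod_p r :: 'p mod_ring)"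
proof -
  let ?p = "CARD('p)"
  obtain a b where ab: "\<not> ?p dvd b" "b \<noteq> 0" "q = of_int a / of_nat b" using q by (rule p_localE)
  obtain c d where cd: "\<not> ?p dvd d" "d \<noteq> 0" "r = of_int c / of_nat d" using r by (rule p_localE)
  have bd: "\<not> ?p dvd b * d"
    using ab(1) cd(1) prime_card[where 'a='p] by (simp add: prime_dvd_mult_iff)
  have nz: "(of_nat b :: 'p mod_ring) \<noteq> 0" "(of_nat d :: 'p mod_ring) \<noteq> 0"
    using ab(1) cd(1) by (simp_all add: of_nat_mod_ring_eq_0_iff)
  have eq: "q + r = of_int (a * int d + c * int b) / of_nat (b * d)"
    "q - r = of_int (a * int d - c * int b) / of_nat (b * d)"
    "q * r = of_int (a * c) / of_nat (b * d)"
    unfolding ab(3) cd(3) using ab(2) cd(2) by (simp_all add: add_frac_eq diff_frac_eq)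
  show "mod_p (q + r) = (mod_p q + mod_p r :: 'p mod_ring)"
    unfolding eq(1) mod_p_fraction[OF bd]
    unfolding ab(3) cd(3) mod_p_fraction[OF ab(1)] mod_p_fraction[OF cd(1)]
    using nz by (simp add: add_frac_eq diff_frac_eq)
  show "mod_p (q - r) = (mod_p q - mod_p r :: 'p mod_ring)"
    unfolding eq(2) mod_p_fraction[OF bd]
    unfolding ab(3) cd(3) mod_p_fraction[OF ab(1)] mod_p_fraction[OF cd(1)]
    using nz by (simp add: add_frac_eq diff_frac_eq)
  show "mod_p (q * r) = (mod_p q * mod_p r :: 'p mod_ring)"
    unfolding eq(3) mod_p_fraction[OF bd]
    unfolding ab(3) cd(3) mod_p_fraction[OF ab(1)] mod_p_fraction[OF cd(1)]
    using nz by (simp add: add_frac_eq diff_frac_eq)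
qed

lemma p_local_divide_p:
  assumes q: "q \<in> p_local CARD('p)" and 0: "mod_p q = (0 :: 'p::prime_card mod_ring)"
  shows "q / of_nat CARD('p) \<in> p_local CARD('p)"
proof -
  let ?p = "CARD('p)"
  obtain a b where ab: "\<not> ?p dvd b" "b \<noteq> 0" "q = of_int a / of_nat b" using q by (rule p_localE)
  have "(of_nat b :: 'p mod_ring) \<noteq> 0" using ab(1) by (simp add: of_nat_mod_ring_eq_0_iff)
  then have "(of_int a :: 'p mod_ring) = 0"
    using 0 unfolding ab(3) mod_p_fraction[OF ab(1)] by simp
  then obtain k where "a = int ?p * k" by (auto simp: of_int_mod_ring_eq_0_iff)
  then have "q / of_nat ?p = of_int k / of_nat b" using ab(3) by simp
  then show ?thesis using ab(1) unfolding p_local_iff by blast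
qed

lemma lookup_mpoly_mod_p: "Poly_Mapping.lookup (mpoly_mod_p f) t = mod_p (Poly_Mapping.lookup f t)"
  by (simp add: mpoly_mod_p_def map.rep_eq mod_p_0 when_def)

lemma mpoly_mod_p_0: "mpoly_mod_p 0 = 0"
  by (rule poly_mapping_eqI) (simp add: lookup_mpoly_mod_p mod_p_0)

lemma keys_mpoly_mod_p: "Poly_Mapping.keys (mpoly_mod_p f) \<subseteq> Poly_Mapping.keys f"
  by (auto simp: in_keys_iff lookup_mpoly_mod_p mod_p_0)

lemma
  fixes f g :: "('n, rat) mpoly"
  assumes "p_local_mpoly CARD('p) f" and "p_local_mpoly CARD('p) g"
  shows mpoly_mod_p_add: "mpoly_mod_p (f + g) = (mpoly_mod_p f + mpoly_mod_p g :: ('n, 'p::prime_card mod_ring) mpoly)"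
    and mpoly_mod_p_diff: "mpoly_mod_p (f - g) = (mpoly_mod_p f - mpoly_mod_p g :: ('n, 'p mod_ring) mpoly)"
  using assms by (auto intro!: poly_mapping_eqI
      simp: lookup_mpoly_mod_p lookup_add lookup_minus mod_p_add mod_p_diff p_local_mpoly_def)

lemma
  assumes "prime p" "p_local_mpoly p f" "p_local_mpoly p g"
  shows p_local_mpoly_add: "p_local_mpoly p (f + g)"
    and p_local_mpoly_diff: "p_local_mpoly p (f - g)"
  using assms by (auto simp: p_local_mpoly_def lookup_add lookup_minus p_local_add p_local_diff)

lemma p_local_mpoly_0: "prime p \<Longrightarrow> p_local_mpoly p 0"
  using p_local_of_int[of p 0] by (simp add: p_local_mpoly_def)

lemma p_local_mpoly_monomial_mult:
  assumes p: "prime p" and "c \<in> p_local p" and "p_local_mpoly p g"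
  shows "p_local_mpoly p (Poly_Mapping.single u c * g)"
  using assms p_local_of_int[OF p, of 0] unfolding p_local_mpoly_def
  by (auto intro: coeffs_monomial_mult p_local_mult)

lemma mpoly_mod_p_monomial_mult:
  fixes g :: "('n, rat) mpoly"
  assumes c: "c \<in> p_local CARD('p::prime_card)" and g: "p_local_mpoly CARD('p) g"
  shows "mpoly_mod_p (Poly_Mapping.single u c * g) =
    (Poly_Mapping.single u (mod_p c) * mpoly_mod_p g :: ('n, 'p mod_ring) mpoly)"
proof (rule poly_mapping_eqI)
  fix s
  show "Poly_Mapping.lookup (mpoly_mod_p (Poly_Mapping.single u c * g)) s =
    Poly_Mapping.lookup (Poly_Mapping.single u (mod_p c) * mpoly_mod_p g :: ('n, 'p mod_ring) mpoly) s"
  proof (cases "\<exists>t. s = u + t")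
    case True
    then obtain t where "s = u + t" by blast
    then show ?thesis
      using mod_p_mult[OF c] g by (simp add: lookup_mpoly_mod_p lookup_monomial_mult p_local_mpoly_def)
  next
    case False
    then have "s \<notin> Poly_Mapping.keys (Poly_Mapping.single u c * g)"
      "s \<notin> Poly_Mapping.keys (Poly_Mapping.single u (mod_p c) * mpoly_mod_p g :: ('n, 'p mod_ring) mpoly)"
      by (metis keys_monomial_mult)+
    then show ?thesis by (simp add: in_keys_iff lookup_mpoly_mod_p mod_p_0)
  qed
qed

lemma mpoly_mod_p_lift:
  fixes h :: "('n, 'p::prime_card mod_ring) mpoly"
  obtains f where "p_local_mpoly CARD('p) f" "mpoly_mod_p f = h"
    "Poly_Mapping.keys f \<subseteq> Poly_Mapping.keys h"
proof -
  define f where "f = Poly_Mapping.map (\<lambda>c. of_int (to_int_mod_ring c) :: rat) h"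
  have f: "Poly_Mapping.lookup f t = of_int (to_int_mod_ring (Poly_Mapping.lookup h t))" for t
    by (simp add: f_def map.rep_eq when_def)
  show thesis
  proof
    show "p_local_mpoly CARD('p) f"
      using p_local_of_int[OF prime_card[where 'a='p]] by (simp add: p_local_mpoly_def f)
    show "mpoly_mod_p f = h"
      by (rule poly_mapping_eqI)
        (simp add: lookup_mpoly_mod_p f mod_p_of_int of_int_of_int_mod_ring)
    show "Poly_Mapping.keys f \<subseteq> Poly_Mapping.keys h"
      by (auto simp: in_keys_iff f)
  qed
qed

lemma mpoly_mod_p_eq_0_imp_multiple:
  fixes f :: "('n, rat) mpoly"
  assumes f: "p_local_mpoly CARD('p::prime_card) f"
    and 0: "mpoly_mod_p f = (0 :: ('n, 'p mod_ring) mpoly)"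
  obtains e where "p_local_mpoly CARD('p) e" "f = Poly_Mapping.single 0 (of_nat CARD('p)) * e"
proof -
  define q :: rat where "q = of_nat CARD('p)"
  have q: "q \<noteq> 0" by (simp add: q_def)
  let ?e = "Poly_Mapping.single 0 (1 / q) * f"
  have lookup_e: "Poly_Mapping.lookup ?e t = Poly_Mapping.lookup f t / q" for t
    using lookup_monomial_mult[of 0 "1 / q" f t] by simp
  have "Poly_Mapping.lookup ?e t \<in> p_local CARD('p)" for t
  proof -
    have "mod_p (Poly_Mapping.lookup f t) = (0 :: 'p mod_ring)"
      using 0 by (metis lookup_mpoly_mod_p lookup_zero)
    moreover have "Poly_Mapping.lookup f t \<in> p_local CARD('p)"
      using f by (simp add: p_local_mpoly_def)
    ultimately show ?thesis unfolding lookup_e unfolding q_def by (rule p_local_divide_p[rotated])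
  qed
  then have "p_local_mpoly CARD('p) ?e" by (simp add: p_local_mpoly_def)
  moreover have "f = Poly_Mapping.single 0 q * ?e"
    using q by (simp add: mult_single flip: mult.assoc)
  ultimately show thesis using that by (simp only: q_def)
qed

text \<open>The reductions of the \<open>p\<close>-local elements of \<open>I\<close> form an ideal, because every polynomial
  modulo \<open>p\<close> has a lift. It contains the given generators.\<close>

lemma genideal_mod_p_lift:
  fixes I G :: "('n, rat) mpoly set"
    and h :: "('n, 'p::prime_card mod_ring) mpoly"
  assumes I: "ideal I mpoly_ring" and G: "G \<subseteq> I" "\<And>g. g \<in> G \<Longrightarrow> p_local_mpoly CARD('p) g"
    and h: "h \<in> Idl\<^bsub>mpoly_ring\<^esub> (mpoly_mod_p ` G)"
  obtains f where "f \<in> I" "p_local_mpoly CARD('p) f" "mpoly_mod_p f = h"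
proof -
  let ?P = "mpoly_ring :: ('n, 'p mod_ring) mpoly ring"
  let ?loc = "p_local_mpoly CARD('p)"
  interpret P: cring ?P by (rule cring_from_type_algebra)
  have prime: "prime CARD('p)" by (rule prime_card)
  define K :: "('n, 'p mod_ring) mpoly set" where "K = {mpoly_mod_p F | F. F \<in> I \<and> ?loc F}"
  have zero: "0 \<in> K"
    unfolding K_def using ideal_zero[OF I] p_local_mpoly_0[OF prime] mpoly_mod_p_0 by force
  have add: "a + b \<in> K" if "a \<in> K" "b \<in> K" for a b
  proof -
    obtain A B where AB: "A \<in> I" "?loc A" "a = mpoly_mod_p A" "B \<in> I" "?loc B" "b = mpoly_mod_p B"
      using \<open>a \<in> K\<close> \<open>b \<in> K\<close> unfolding K_def by blast
    then have "a + b = mpoly_mod_p (A + B)" by (simp add: mpoly_mod_p_add)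
    then show ?thesis unfolding K_def
      using ideal_add[OF I AB(1,4)] p_local_mpoly_add[OF prime AB(2,5)] by blast
  qed
  have mono: "Poly_Mapping.single u c * a \<in> K" if "a \<in> K" for u c a
  proof -
    obtain A where A: "A \<in> I" "?loc A" "a = mpoly_mod_p A" using \<open>a \<in> K\<close> unfolding K_def by blast
    let ?c = "of_int (to_int_mod_ring c) :: rat"
    have c: "?c \<in> p_local CARD('p)" "mod_p ?c = c"
      by (simp_all add: p_local_of_int[OF prime] mod_p_of_int of_int_of_int_mod_ring)
    then have "Poly_Mapping.single u c * a = mpoly_mod_p (Poly_Mapping.single u ?c * A)"
      using A(2,3) by (simp add: mpoly_mod_p_monomial_mult)
    then show ?thesis unfolding K_def
      using ideal_mult[OF I A(1)] p_local_mpoly_monomial_mult[OF prime c(1) A(2)] by blast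
  qed
  have "x * a \<in> K" if "a \<in> K" for x a
  proof -
    have "(\<Sum>t\<in>T. Poly_Mapping.single t (Poly_Mapping.lookup x t) * a) \<in> K" if "finite T" for T
      using that by (induction T) (simp_all add: zero add mono \<open>a \<in> K\<close>)
    from this[OF finite_keys[of x]] show ?thesis
      by (subst mpoly_eq_sum_monomials[of x]) (simp add: sum_distrib_right)
  qed
  then have "ideal K ?P" using zero add by (simp add: ideal_mpoly_iff)
  moreover have "mpoly_mod_p ` G \<subseteq> K" using G unfolding K_def by blast
  ultimately have "h \<in> K" using P.genideal_minimal h by blast
  then show thesis using that unfolding K_def by blast
qed

section \<open>Normal forms and bases of quotient rings\<close>

lemma quotient_space_simps:
  "carrier (quotient_space J) = carrier (mpoly_ring Quot J)"
  "(\<oplus>\<^bsub>quotient_space J\<^esub>) = (\<oplus>\<^bsub>mpoly_ring Quot J\<^esub>)"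
  "\<zero>\<^bsub>quotient_space J\<^esub> = \<zero>\<^bsub>mpoly_ring Quot J\<^esub>"
  "c \<odot>\<^bsub>quotient_space J\<^esub> A =
    (J +>\<^bsub>mpoly_ring\<^esub> Poly_Mapping.single 0 c) \<otimes>\<^bsub>mpoly_ring Quot J\<^esub> A"
  by (simp_all add: quotient_space_def Let_def)

text \<open>The polynomials with all terms in \<open>N\<close> represent the residue classes: existence of remainders
  gives the spanning property, uniqueness gives linear independence.\<close>

lemma quotient_space_basis:
  fixes J :: "('n, 'a::Fields.field) mpoly set"
  assumes J: "ideal J mpoly_ring"
    and ex: "\<And>f. \<exists>r. f - r \<in> J \<and> Poly_Mapping.keys r \<subseteq> N"
    and indep: "\<And>f. f \<in> J \<Longrightarrow> Poly_Mapping.keys f \<subseteq> N \<Longrightarrow> f = 0"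
  shows "vectorspace.basis (ring_of_type_algebra :: 'a ring) (quotient_space J)
    ((\<lambda>t. J +>\<^bsub>mpoly_ring\<^esub> Poly_Mapping.single t 1) ` N)"
proof -
  let ?P = "mpoly_ring :: ('n, 'a) mpoly ring"
  let ?K = "ring_of_type_algebra :: 'a ring"
  let ?V = "quotient_space J"
  define q where "q f = J +>\<^bsub>?P\<^esub> f" for f
  define cls where "cls t = q (Poly_Mapping.single t 1)" for t
  interpret P: cring ?P by (rule cring_from_type_algebra)
  interpret J: ideal J ?P by fact
  interpret V: vectorspace ?K ?V by (rule quotient_space_vectorspace) fact
  have P_simps: "carrier ?P = UNIV" "(\<otimes>\<^bsub>?P\<^esub>) = (*)" "(\<oplus>\<^bsub>?P\<^esub>) = (+)" "\<zero>\<^bsub>?P\<^esub> = 0"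
    by (simp_all add: ring_of_type_algebra_def)
  have K_simps: "carrier ?K = UNIV" "\<zero>\<^bsub>?K\<^esub> = 0"
    by (simp_all add: ring_of_type_algebra_def)
  have minus: "f \<ominus>\<^bsub>?P\<^esub> g = f - g" for f g
    using P.minus_equality[of "- g" g] by (simp add: a_minus_def P_simps)
  have q_eq: "q f = q g \<longleftrightarrow> f - g \<in> J" for f g
    using P.quotient_eq_iff_same_a_r_cos[OF J, of f g] by (simp add: q_def P_simps minus)
  have hom: "q \<in> Ring.ring_hom ?P (?P Quot J)"
    unfolding q_def by (rule J.rcos_ring_hom)
  have q_carrier: "q f \<in> carrier ?V" for f
    using Ring.ring_hom_closed[OF hom] by (simp add: quotient_space_simps P_simps)
  have carrier_V: "carrier ?V = range q"
    by (auto simp: quotient_space_simps FactRing_def A_RCOSETS_def' P_simps q_def)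
  have q_add: "q (f + g) = q f \<oplus>\<^bsub>?V\<^esub> q g" for f g
    using Ring.ring_hom_add[OF hom, of f g] by (simp add: quotient_space_simps P_simps)
  have q_smult: "c \<odot>\<^bsub>?V\<^esub> q f = q (Poly_Mapping.single 0 c * f)" for c f
    using Ring.ring_hom_mult[OF hom, of "Poly_Mapping.single 0 c" f]
    by (simp add: quotient_space_simps P_simps q_def)
  have q_0: "q 0 = \<zero>\<^bsub>?V\<^esub>"
  proof -
    have "q 0 \<oplus>\<^bsub>?V\<^esub> q 0 = q 0" by (simp flip: q_add)
    then show ?thesis using q_carrier[of 0] by (metis V.module.M.add.r_cancel_one)
  qed
  have finsum_q: "(\<Oplus>\<^bsub>?V\<^esub>t\<in>T. q (b t)) = q (\<Sum>t\<in>T. b t)" if "finite T" for T b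
    using that by (induction T) (simp_all add: q_0 q_add q_carrier)
  have inj: "inj_on cls N"
  proof
    fix s t assume st: "s \<in> N" "t \<in> N" "cls s = cls t"
    let ?d = "Poly_Mapping.single s 1 - Poly_Mapping.single t 1 :: ('n, 'a) mpoly"
    have "?d = 0"
      using st keys_diff[of "Poly_Mapping.single s (1::'a)" "Poly_Mapping.single t 1"]
      by (intro indep) (auto simp: cls_def q_eq)
    then show "s = t" by (metis eq_iff_diff_eq_0 lookup_single_eq lookup_single_not_eq zero_neq_one)
  qed
  have lincomb: "V.lincomb a (cls ` T) = q (\<Sum>t\<in>T. Poly_Mapping.single t (a (cls t)))"
    if T: "finite T" "T \<subseteq> N" for a T
  proof -
    have "V.lincomb a (cls ` T) = (\<Oplus>\<^bsub>?V\<^esub>t\<in>T. a (cls t) \<odot>\<^bsub>?V\<^esub> cls t)"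
      unfolding V.lincomb_def using inj_on_subset[OF inj T(2)]
      by (intro V.module.M.finsum_reindex) (auto simp: cls_def q_smult q_carrier)
    also have "\<dots> = (\<Oplus>\<^bsub>?V\<^esub>t\<in>T. q (Poly_Mapping.single t (a (cls t))))"
      by (simp add: cls_def q_smult mult_single)
    also have "\<dots> = q (\<Sum>t\<in>T. Poly_Mapping.single t (a (cls t)))" by (rule finsum_q) fact
    finally show ?thesis .
  qed
  have lookup_sum_single: "Poly_Mapping.lookup (\<Sum>t\<in>T. Poly_Mapping.single t (b t)) s =
      (if s \<in> T then b s else 0)" if "finite T" for T s and b :: "'n pp \<Rightarrow> 'a"
    using that by (auto simp: lookup_sum lookup_single when_def sum.delta')
  have "V.lin_indpt (cls ` N)"
  proof
    assume "V.lin_dep (cls ` N)"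
    then obtain A a v where A: "finite A" "A \<subseteq> cls ` N" "V.lincomb a A = \<zero>\<^bsub>?V\<^esub>" "v \<in> A" "a v \<noteq> 0"
      unfolding V.lin_dep_def K_simps by blast
    obtain T where T: "finite T" "T \<subseteq> N" "A = cls ` T"
      using finite_subset_image[OF A(1,2)] by blast
    let ?f = "\<Sum>t\<in>T. Poly_Mapping.single t (a (cls t))"
    have "q ?f = q 0" using A(3) lincomb[OF T(1,2)] by (simp add: T(3) q_0)
    then have "?f \<in> J" by (simp add: q_eq)
    moreover have "Poly_Mapping.keys ?f \<subseteq> N"
      using T(2) by (auto simp: in_keys_iff lookup_sum_single[OF T(1)] split: if_splits)
    ultimately have "?f = 0" by (rule indep)
    then have "a (cls t) = 0" if "t \<in> T" for t
      using lookup_sum_single[OF T(1), of "\<lambda>t. a (cls t)" t] that by simp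
    then show False using A(4,5) T(3) by blast
  qed
  moreover have "V.span (cls ` N) = carrier ?V"
  proof
    show "V.span (cls ` N) \<subseteq> carrier ?V"
      by (rule V.span_is_subset2) (auto simp: cls_def q_carrier)
    show "carrier ?V \<subseteq> V.span (cls ` N)"
    proof
      fix x assume "x \<in> carrier ?V"
      then obtain f where x: "x = q f" using carrier_V by blast
      obtain r where r: "f - r \<in> J" "Poly_Mapping.keys r \<subseteq> N" using ex by blast
      define a where "a = (\<lambda>A. Poly_Mapping.lookup r (the_inv_into N cls A))"
      have a: "a (cls t) = Poly_Mapping.lookup r t" if "t \<in> N" for t
        using the_inv_into_f_f[OF inj that] by (simp add: a_def)
      have "(\<Sum>t\<in>Poly_Mapping.keys r. Poly_Mapping.single t (a (cls t))) =
          (\<Sum>t\<in>Poly_Mapping.keys r. Poly_Mapping.single t (Poly_Mapping.lookup r t))"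
        using r(2) by (intro sum.cong) (auto simp: a)
      also have "\<dots> = r" by (rule mpoly_eq_sum_monomials[symmetric])
      finally have "V.lincomb a (cls ` Poly_Mapping.keys r) = x"
        using lincomb[OF finite_keys r(2), of a] r(1) by (simp add: x q_eq[of f r, THEN iffD2])
      then show "x \<in> V.span (cls ` N)"
        unfolding V.span_def using r(2) K_simps(1)
        by (intro CollectI exI[of _ a] exI[of _ "cls ` Poly_Mapping.keys r"]) auto
    qed
  qed
  moreover have "cls ` N \<subseteq> carrier ?V" by (auto simp: cls_def q_carrier)
  ultimately have "V.basis (cls ` N)" unfolding V.basis_def by blast
  then show ?thesis by (simp add: cls_def q_def)
qed

section \<open>Normal forms modulo a prime\<close>

context
  fixes \<sigma> :: "'n::finite pp rel"
    and I G :: "('n, rat) mpoly set"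
    and J :: "('n, 'p::prime_card mod_ring) mpoly set"
  assumes ord: "term_ordering \<sigma>"
    and I: "ideal I mpoly_ring"
    and G: "groebner_basis \<sigma> G I"
    and monic: "\<And>g. g \<in> G \<Longrightarrow> Poly_Mapping.lookup g (LT \<sigma> g) = 1"
    and loc_G: "\<And>g. g \<in> G \<Longrightarrow> p_local_mpoly CARD('p) g"
    and J: "J = Idl\<^bsub>mpoly_ring\<^esub> (mpoly_mod_p ` G)"
begin

lemma ideal_J: "ideal J mpoly_ring"
proof -
  interpret P: cring "mpoly_ring :: ('n, 'p mod_ring) mpoly ring" by (rule cring_from_type_algebra)
  show ?thesis unfolding J by (rule P.genideal_ideal) (simp add: ring_of_type_algebra_def)
qed

lemma generators_in_J: "mpoly_mod_p ` G \<subseteq> J"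
proof -
  interpret P: cring "mpoly_ring :: ('n, 'p mod_ring) mpoly ring" by (rule cring_from_type_algebra)
  show ?thesis unfolding J by (rule P.genideal_self) (simp add: ring_of_type_algebra_def)
qed

lemma division_mod_p:
  assumes f: "p_local_mpoly CARD('p) f"
  obtains r where "p_local_mpoly CARD('p) r" "f - r \<in> I" "mpoly_mod_p f - mpoly_mod_p r \<in> J"
    "Poly_Mapping.keys r \<subseteq> - LT_set \<sigma> I"
proof -
  let ?loc = "p_local_mpoly CARD('p)"
  let ?\<pi> = "mpoly_mod_p :: ('n, rat) mpoly \<Rightarrow> ('n, 'p mod_ring) mpoly"
  have prime: "prime CARD('p)" by (rule prime_card)
  \<comment> \<open>Membership in \<open>J\<close> modulo \<open>p\<close> is carried along with membership in \<open>I\<close>.\<close>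
  let ?M = "{F \<in> I. ?loc F \<and> ?\<pi> F \<in> J}"
  have "\<exists>r. (\<forall>t. Poly_Mapping.lookup r t \<in> p_local CARD('p)) \<and> f - r \<in> ?M
    \<and> (\<forall>s\<in>Poly_Mapping.keys r. \<not> (\<exists>g\<in>G. pp_dvd (LT \<sigma> g) s))
    \<and> (\<forall>s\<in>Poly_Mapping.keys r. \<exists>t\<in>Poly_Mapping.keys f. (s, t) \<in> \<sigma>)"
  proof (rule division_by_monic[OF ord])
    show "0 \<in> p_local CARD('p)" using p_local_of_int[OF prime, of 0] by simp
    show "0 \<in> ?M"
      by (simp add: ideal_zero[OF I] ideal_zero[OF ideal_J] p_local_mpoly_0[OF prime] mpoly_mod_p_0)
    show "a + b \<in> ?M" if "a \<in> ?M" "b \<in> ?M" for a b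
      using that by (simp add: ideal_add[OF I] ideal_add[OF ideal_J] p_local_mpoly_add[OF prime]
          mpoly_mod_p_add)
    show "Poly_Mapping.single u c * g \<in> ?M" if "g \<in> G" "c \<in> p_local CARD('p)" for g u c
      using that loc_G[OF that(1)] G generators_in_J
      by (auto simp: p_local_mpoly_monomial_mult[OF prime] mpoly_mod_p_monomial_mult
          groebner_basis_def intro!: ideal_mult[OF I] ideal_mult[OF ideal_J])
  qed (use f loc_G monic p_local_add p_local_diff p_local_mult prime
      in \<open>auto simp: p_local_mpoly_def\<close>)
  then obtain r where r: "?loc r" "f - r \<in> ?M"
    "\<forall>s\<in>Poly_Mapping.keys r. \<not> (\<exists>g\<in>G. pp_dvd (LT \<sigma> g) s)"
    unfolding p_local_mpoly_def by blast
  have "?\<pi> (f - r) = ?\<pi> f - ?\<pi> r" using f r(1) by (rule mpoly_mod_p_diff)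
  moreover have "Poly_Mapping.keys r \<subseteq> - LT_set \<sigma> I"
    using r(3) by (auto simp: LT_set_groebner_basis[OF ord I G])
  ultimately show thesis using that[of r] r(1,2) by simp
qed

text \<open>This transfers the uniqueness of normal forms from \<open>I\<close> to \<open>J\<close>. A lift of \<open>h\<close> to \<open>I\<close> and a
  lift without any terms but those of \<open>h\<close> differ by \<open>p\<close> times some polynomial \<open>E\<close>. Replacing \<open>E\<close> by
  its normal form changes the first lift by an element of \<open>I\<close> and leaves it without terms in
  \<open>LT_set \<sigma> I\<close>. So it becomes 0, and \<open>h\<close> is its reduction.\<close>

lemma irreducible_mod_p_eq_0:
  assumes h: "h \<in> J" "Poly_Mapping.keys h \<subseteq> - LT_set \<sigma> I"
  shows "h = 0"
proof -
  let ?loc = "p_local_mpoly CARD('p)"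
  let ?\<pi> = "mpoly_mod_p :: ('n, rat) mpoly \<Rightarrow> ('n, 'p mod_ring) mpoly"
  have prime: "prime CARD('p)" by (rule prime_card)
  have GI: "G \<subseteq> I" using G by (auto simp: groebner_basis_def)
  obtain F where F: "F \<in> I" "?loc F" "?\<pi> F = h"
    by (rule genideal_mod_p_lift[OF I GI loc_G h(1)[unfolded J]])
  obtain H where H: "?loc H" "?\<pi> H = h" "Poly_Mapping.keys H \<subseteq> Poly_Mapping.keys h"
    by (rule mpoly_mod_p_lift)
  define q :: rat where "q = of_nat CARD('p)"
  have "?\<pi> (F - H) = 0" using F(2,3) H(1,2) by (simp add: mpoly_mod_p_diff)
  then obtain E where E: "?loc E" "F - H = Poly_Mapping.single 0 q * E"
    unfolding q_def by (rule mpoly_mod_p_eq_0_imp_multiple[OF p_local_mpoly_diff[OF prime F(2) H(1)]])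
  obtain r where r: "?loc r" "E - r \<in> I" "Poly_Mapping.keys r \<subseteq> - LT_set \<sigma> I"
    using division_mod_p[OF E(1)] by blast
  let ?pr = "Poly_Mapping.single 0 q * r"
  have "F - Poly_Mapping.single 0 q * (E - r) = H + ?pr"
    using E(2) by (simp add: right_diff_distrib algebra_simps)
  then have "H + ?pr \<in> I" using ideal_diff[OF I F(1) ideal_mult[OF I r(2)]] by metis
  moreover have "Poly_Mapping.keys (H + ?pr) \<subseteq> - LT_set \<sigma> I"
  proof -
    have "Poly_Mapping.keys ?pr \<subseteq> Poly_Mapping.keys r" by (auto elim!: keys_monomial_mult)
    then show ?thesis using keys_add[of H ?pr] H(3) h(2) r(3) by blast
  qed
  ultimately have zero: "H + ?pr = 0" by (rule irreducible_in_ideal_eq_0[OF ord])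
  have q: "q \<in> p_local CARD('p)"
    using p_local_of_int[OF prime, of "int CARD('p)"] by (simp add: q_def)
  have "mod_p q = (0 :: 'p mod_ring)"
    using mod_p_of_int[of "int CARD('p)", where 'a='p] by (simp add: q_def of_nat_mod_ring_eq_0_iff)
  then have "?\<pi> ?pr = 0" using mpoly_mod_p_monomial_mult[OF q r(1), of 0] by simp
  moreover have "?\<pi> (H + ?pr) = ?\<pi> H + ?\<pi> ?pr"
    by (intro mpoly_mod_p_add H(1) p_local_mpoly_monomial_mult[OF prime q r(1)])
  ultimately show "h = 0" using zero H(2) by (simp add: mpoly_mod_p_0)
qed

end

section \<open>The reduced Groebner basis modulo a prime\<close>

theorem theorem3p7:
  fixes \<sigma> :: "'n::finite pp rel"
    and I G :: "('n, rat) mpoly set"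
    and \<pi> :: "('n, rat) mpoly \<Rightarrow> ('n, 'p::prime_card mod_ring) mpoly"
    and J :: "('n, 'p mod_ring) mpoly set"
    and p :: nat
  defines "\<pi> \<equiv> mpoly_mod_p"
    and "J \<equiv> Idl\<^bsub>mpoly_ring\<^esub> (\<pi> ` G)"
  assumes "term_ordering \<sigma>"
    and "ideal I mpoly_ring" and "I \<noteq> {0}"
    and "reduced_groebner_basis \<sigma> G I"
    and "p = CARD('p)"
    and "\<not> p dvd den_ideal \<sigma> I"
  shows "reduced_groebner_basis \<sigma> (\<pi> ` G) J
    \<and> vectorspace.basis (ring_of_type_algebra :: 'p mod_ring ring) (quotient_space J)
        ((\<lambda>t. J +>\<^bsub>mpoly_ring\<^esub> Poly_Mapping.single t 1) ` (- LT_set \<sigma> I))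
    \<and> (\<forall>f. \<not> p dvd den f \<longrightarrow>
        \<not> p dvd den (NF \<sigma> I f) \<and> \<pi> (NF \<sigma> I f) = NF \<sigma> J (\<pi> f))"
proof -
  let ?loc = "p_local_mpoly CARD('p)"
  note ord = assms(3) and I = assms(4) and G = assms(6) and p = assms(7)
  have prime: "prime CARD('p)" by (rule prime_card)
  have gb: "groebner_basis \<sigma> G I" and monic: "\<And>g. g \<in> G \<Longrightarrow> Poly_Mapping.lookup g (LT \<sigma> g) = 1"
    using G by (auto simp: reduced_groebner_basis_def)
  have GI: "finite G" "0 \<notin> G" using gb by (auto simp: groebner_basis_def)

  have loc_G: "?loc g" if "g \<in> G" for g
  proof -
    have "den g dvd den_ideal \<sigma> I"
      unfolding den_ideal_eq[OF ord I G] using that by (intro dvd_Lcm) auto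
    then have "\<not> CARD('p) dvd den g" using assms(8) p dvd_trans by blast
    then show ?thesis using not_dvd_den_iff[OF prime] by blast
  qed
  have J_def': "J = Idl\<^bsub>mpoly_ring\<^esub> (mpoly_mod_p ` G)" by (simp add: J_def \<pi>_def)
  note setting = ord I gb monic loc_G J_def'
  have J: "ideal J mpoly_ring" using setting by (rule ideal_J)
  have \<pi>G: "\<pi> ` G \<subseteq> J" unfolding \<pi>_def using setting by (rule generators_in_J)
  have division: "\<exists>r. ?loc r \<and> f - r \<in> I \<and> \<pi> f - \<pi> r \<in> J
      \<and> Poly_Mapping.keys r \<subseteq> - LT_set \<sigma> I" if "?loc f" for f
    unfolding \<pi>_def using division_mod_p[OF setting that] by blast
  have irred: "h = 0" if "h \<in> J" "Poly_Mapping.keys h \<subseteq> - LT_set \<sigma> I" for h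
    using setting that by (rule irreducible_mod_p_eq_0)

  have LT_\<pi>: "LT \<sigma> (\<pi> g) = LT \<sigma> g" and monic_\<pi>: "Poly_Mapping.lookup (\<pi> g) (LT \<sigma> g) = 1"
    if "g \<in> G" for g
  proof -
    show 1: "Poly_Mapping.lookup (\<pi> g) (LT \<sigma> g) = 1"
      using monic[OF that] by (simp add: \<pi>_def lookup_mpoly_mod_p mod_p_1)
    have "g \<noteq> 0" using GI(2) that by blast
    show "LT \<sigma> (\<pi> g) = LT \<sigma> g"
    proof (rule LT_eqI[OF ord])
      show "LT \<sigma> g \<in> Poly_Mapping.keys (\<pi> g)" using 1 by (simp add: in_keys_iff)
      show "(s, LT \<sigma> g) \<in> \<sigma>" if "s \<in> Poly_Mapping.keys (\<pi> g)" for s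
        using that keys_mpoly_mod_p unfolding \<pi>_def by (blast intro: LT_ge[OF ord \<open>g \<noteq> 0\<close>])
    qed
  qed

  have dvd_\<pi>: "(\<exists>g\<in>\<pi> ` G. pp_dvd (LT \<sigma> g) t) \<longleftrightarrow> t \<in> LT_set \<sigma> I" for t
    by (simp add: LT_\<pi> LT_set_groebner_basis[OF ord I gb])
  have gb_\<pi>: "groebner_basis \<sigma> (\<pi> ` G) J"
  proof (rule groebner_basisI[OF ord J _ \<pi>G])
    show "h = 0" if "h \<in> J" "\<forall>s\<in>Poly_Mapping.keys h. \<not> (\<exists>g\<in>\<pi> ` G. pp_dvd (LT \<sigma> g) s)" for h
      using that(2) unfolding dvd_\<pi> by (intro irred[OF that(1)]) blast
  qed (use GI(1) LT_\<pi> monic_\<pi> in auto)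
  have LT_set_J: "LT_set \<sigma> J = LT_set \<sigma> I"
    using LT_set_groebner_basis[OF ord J gb_\<pi>] dvd_\<pi> by blast

  have "reduced_groebner_basis \<sigma> (\<pi> ` G) J"
    unfolding reduced_groebner_basis_def
  proof (intro conjI ballI)
    fix g h t
    assume "g \<in> \<pi> ` G" "h \<in> \<pi> ` G - {g}" and t: "t \<in> Poly_Mapping.keys g"
    then obtain g' h' where gh: "g' \<in> G" "g = \<pi> g'" "h' \<in> G - {g'}" "h = \<pi> h'" by blast
    have "t \<in> Poly_Mapping.keys g'" using t keys_mpoly_mod_p gh(2) by (auto simp: \<pi>_def)
    then have "\<not> pp_dvd (LT \<sigma> h') t" using G gh(1,3) by (auto simp: reduced_groebner_basis_def)
    then show "\<not> pp_dvd (LT \<sigma> h) t" using gh(3,4) by (simp add: LT_\<pi>)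
  qed (use gb_\<pi> LT_\<pi> monic_\<pi> in auto)
  moreover have "vectorspace.basis (ring_of_type_algebra :: 'p mod_ring ring) (quotient_space J)
      ((\<lambda>t. J +>\<^bsub>mpoly_ring\<^esub> Poly_Mapping.single t 1) ` (- LT_set \<sigma> I))"
  proof (rule quotient_space_basis[OF J])
    fix f :: "('n, 'p mod_ring) mpoly"
    obtain F where F: "?loc F" "\<pi> F = f"
      unfolding \<pi>_def using mpoly_mod_p_lift[of f] by metis
    obtain r where "\<pi> F - \<pi> r \<in> J" "Poly_Mapping.keys r \<subseteq> - LT_set \<sigma> I"
      using division[OF F(1)] by blast
    then show "\<exists>r. f - r \<in> J \<and> Poly_Mapping.keys r \<subseteq> - LT_set \<sigma> I"
      using keys_mpoly_mod_p[of r] F(2) by (intro exI[of _ "\<pi> r"]) (auto simp: \<pi>_def)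
  qed (rule irred)
  moreover have "\<not> p dvd den (NF \<sigma> I f) \<and> \<pi> (NF \<sigma> I f) = NF \<sigma> J (\<pi> f)" if "\<not> p dvd den f" for f
  proof -
    have "?loc f" using that p not_dvd_den_iff[OF prime] by blast
    then obtain r where r: "?loc r" "f - r \<in> I" "\<pi> f - \<pi> r \<in> J"
      "Poly_Mapping.keys r \<subseteq> - LT_set \<sigma> I" using division by blast
    have "NF \<sigma> I f = r" by (rule NF_eqI[OF ord I r(2,4)])
    moreover have "NF \<sigma> J (\<pi> f) = \<pi> r"
      using r(3,4) keys_mpoly_mod_p[of r]
      by (intro NF_eqI[OF ord J]) (auto simp: LT_set_J \<pi>_def)
    ultimately show ?thesis using r(1) p not_dvd_den_iff[OF prime, of r] by simp
  qed
  ultimately show ?thesis by blast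
qed

end
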